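(* Let $n_x,n_r,n_b$ be positive integers with $n_r<n_x$. Let $Q\in\mathbb{R}^{n_x\times n_x}$ and $\mathcal{T}_\nu\in\mathbb{R}^{n_r\times n_r}$ be symmetric positive definite, let $S\in\mathbb{R}^{n_r\times n_x}$ and $W_b\in\mathbb{R}^{n_r\times n_b}$ have full row rank, and let $t_b\ge0$. Consider the input-output dual ascent system $G$ with state $\nu\in\mathbb{R}^{n_r}$, input $\eta_b\in\mathbb{R}^{n_b}$ and output $z\in\mathbb{R}^{n_x}$: $$\mathcal{T}_\nu\dot\nu=-SQ^{-1}S^{\sf T}\nu-t_bW_b\,\eta_b,\qquad z=-Q^{-1/2}S^{\sf T}\nu .$$ Then $$\|G\|_{\mathcal{H}_2}^2=\frac{t_b^2}{2}\,\mathrm{Tr}\big(W_b^{\sf T}\mathcal{T}_\nu^{-1}W_b\big).$$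
   Context: For an LTI system $\dot\xi=A\xi+B\eta$, $z=C\xi$ with $A$ Hurwitz, the $\mathcal{H}_2$ norm from $\eta$ to $z$ is defined by $\|G\|_{\mathcal{H}_2}^2=\frac{1}{2\pi}\int_{-\infty}^{\infty}\mathrm{Tr}\big(G(-j\omega)^{\sf T}G(j\omega)\big)\,d\omega$ with $G(j\omega)=C(j\omega I-A)^{-1}B$. Equivalently, $\|G\|_{\mathcal{H}_2}^2=\mathrm{Tr}(B^{\sf T}XB)$, where $X=X^{\sf T}\succeq 0$ is the unique solution of $A^{\sf T}X+XA+C^{\sf T}C=0$. The system is gradient ascent on the dual function of the problem of minimizing $\frac12x^{\sf T}Qx+c^{\sf T}x$ subject to $Sx=W_bb$, with disturbance $b\mapsto b+t_b\eta_b$, in coordinates shifted to the equilibrium. *)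

theory Defs
  imports "HOL-Analysis.Analysis"
begin

definition pos_def :: "real^'n^'n \<Rightarrow> bool" where
  "pos_def M \<longleftrightarrow> transpose M = M \<and> (\<forall>x. x \<noteq> 0 \<longrightarrow> x \<bullet> (M *v x) > 0)"

text \<open>Meant only for positive definite \<open>M\<close>, where such a square root exists and is unique.\<close>

definition pd_sqrt :: "real^'n^'n \<Rightarrow> real^'n^'n" where
  "pd_sqrt M = (THE R. pos_def R \<and> R ** R = M)"

abbreviation complex_matrix :: "real^'n^'m \<Rightarrow> complex^'n^'m" where
  "complex_matrix \<equiv> map_matrix complex_of_real"

definition hurwitz :: "real^'n^'n \<Rightarrow> bool" where
  "hurwitz A \<longleftrightarrow>
     (\<forall>l v. v \<noteq> 0 \<and> complex_matrix A *v v = l *s v \<longrightarrow> Re l < 0)"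

text \<open>Throughout, \<open>(A, B, C)\<close> stands for the system \<open>\<xi>' = A \<xi> + B \<eta>\<close>, \<open>z = C \<xi>\<close>.
  Note that \<open>mat s\<close> is the scalar matrix \<open>s I\<close>.\<close>

definition transfer_function ::
    "real^'n^'n \<Rightarrow> real^'m^'n \<Rightarrow> real^'n^'p \<Rightarrow> complex \<Rightarrow> complex^'m^'p" where
  "transfer_function A B C s =
     complex_matrix C ** matrix_inv (mat s - complex_matrix A) ** complex_matrix B"

text \<open>The integrand below is real, since \<open>G (- j \<omega>)\<close> is the entrywise conjugate of \<open>G (j \<omega>)\<close>;
  \<open>Re\<close> only changes the type. The value is meaningful only for Hurwitz \<open>A\<close>.\<close>

definition h2_norm :: "real^'n^'n \<Rightarrow> real^'m^'n \<Rightarrow> real^'n^'p \<Rightarrow> real" where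
  "h2_norm A B C =
     (let G = transfer_function A B C in
      sqrt (1 / (2 * pi) *
        Re (LBINT \<omega>. trace (transpose (G (- (\<i> * complex_of_real \<omega>)))
                              ** G (\<i> * complex_of_real \<omega>)))))"

text \<open>State, input and output matrices of
  \<open>T \<nu>' = - S Q\<^sup>-\<^sup>1 S\<^sup>T \<nu> - t W \<eta>\<close>, \<open>z = - Q^(-1/2) S\<^sup>T \<nu>\<close>, solved for \<open>\<nu>'\<close>.\<close>

definition dual_ascent_A :: "real^'r^'r \<Rightarrow> real^'x^'x \<Rightarrow> real^'x^'r \<Rightarrow> real^'r^'r" where
  "dual_ascent_A T Q S = - (matrix_inv T ** (S ** matrix_inv Q ** transpose S))"

definition dual_ascent_B :: "real^'r^'r \<Rightarrow> real \<Rightarrow> real^'b^'r \<Rightarrow> real^'b^'r" where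
  "dual_ascent_B T t W = - (t *\<^sub>R (matrix_inv T ** W))"

definition dual_ascent_C :: "real^'x^'x \<Rightarrow> real^'x^'r \<Rightarrow> real^'r^'x" where
  "dual_ascent_C Q S = - (pd_sqrt (matrix_inv Q) ** transpose S)"

lemma pos_def_invertible:
  assumes "pos_def M"
  shows "invertible M"
proof -
  have "x = 0" if "M *v x = 0" for x
    using assms that unfolding pos_def_def by (metis inner_zero_right less_irrefl)
  then show ?thesis
    by (metis invertible_left_inverse matrix_left_invertible_ker)
qed

lemma matrix_vector_mult_uminus: "(- M) *v x = - (M *v (x :: real^'n))"
  by (simp add: vec_eq_iff matrix_vector_mult_def sum_negf)

lemma dual_ascent_dynamics:
  assumes "pos_def T"
  shows "\<nu>' = dual_ascent_A T Q S *v \<nu> + dual_ascent_B T t W *v \<eta> \<longleftrightarrow>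
         T *v \<nu>' = - ((S ** matrix_inv Q ** transpose S) *v \<nu>) - t *\<^sub>R (W *v \<eta>)"
    (is "\<nu>' = ?f \<longleftrightarrow> T *v \<nu>' = ?g")
proof -
  have inv: "T ** matrix_inv T = mat 1" "matrix_inv T ** T = mat 1"
    using pos_def_invertible[OF assms]
    unfolding invertible_def matrix_inv_def by (metis (mono_tags, lifting) someI_ex)+
  have eq: "?f = matrix_inv T *v ?g"
    by (simp add: dual_ascent_A_def dual_ascent_B_def matrix_vector_mult_uminus
        matrix_vector_mult_diff_distrib matrix_vector_mul_assoc [symmetric]
        scaleR_matrix_vector_assoc [symmetric] matrix_vector_mult_scaleR
        linear_neg [OF matrix_vector_mul_linear])
  show ?thesis
    unfolding eq by (metis inv matrix_vector_mul_assoc matrix_vector_mul_lid)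
qed

end

theory Submission
  imports Defs "HOL-Probability.Sinc_Integral"
begin

text \<open>Put \<open>K = S Q\<^sup>-\<^sup>1 S\<^sup>T\<close>, so \<open>A = - T\<^sup>-\<^sup>1 K\<close>, and diagonalise \<open>T\<close> and \<open>K\<close> simultaneously:
  \<open>P\<^sup>T T P = I\<close> and \<open>P\<^sup>T K P = diag d\<close> with \<open>d > 0\<close>. The modal coordinates \<open>P\<^sup>-\<^sup>1 \<nu>\<close> decouple the dynamics,
  and since \<open>C\<^sup>T C = K\<close> they also decouple the output energy. The integrand is therefore
  \<open>\<Sum>\<^sub>i \<parallel>(P\<^sup>-\<^sup>1 B)\<^sub>i\<parallel>\<^sup>2 d\<^sub>i / (d\<^sub>i\<^sup>2 + \<omega>\<^sup>2)\<close>, each fraction integrates to \<open>\<pi>\<close> whatever \<open>d\<^sub>i\<close> is,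
  and what remains is \<open>Tr (B\<^sup>T P\<^sup>-\<^sup>T P\<^sup>-\<^sup>1 B) / 2 = Tr (B\<^sup>T T B) / 2\<close>, with \<open>B = - t T\<^sup>-\<^sup>1 W\<close>.\<close>

subsection \<open>Orthogonal diagonalisation of symmetric matrices\<close>

text \<open>The quadratic form \<open>x \<bullet> f x\<close> attains its maximum on the compact
  unit sphere of \<open>V\<close>; the first-order condition there, tested inside \<open>V\<close>,
  is the eigenvector equation.\<close>

lemma self_adjoint_eigenvector_in_subspace:
  fixes f :: "'a::euclidean_space \<Rightarrow> 'a"
  assumes f: "linear f" and sa: "\<And>x y. f x \<bullet> y = x \<bullet> f y"
    and V: "subspace V" and inv: "\<And>x. x \<in> V \<Longrightarrow> f x \<in> V"
    and ne: "\<exists>x\<in>V. x \<noteq> 0"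
  obtains v \<mu> where "v \<in> V" "norm v = 1" "f v = \<mu> *\<^sub>R v"
proof -
  have "compact (sphere 0 1 \<inter> V)"
    using closed_subspace[OF V] by (simp add: compact_Int_closed)
  moreover obtain x where "x \<in> V" "x \<noteq> 0"
    using ne by blast
  then have "x /\<^sub>R norm x \<in> sphere 0 1 \<inter> V"
    using V by (simp add: subspace_scale)
  then have "sphere 0 1 \<inter> V \<noteq> {}"
    by blast
  moreover have "continuous_on (sphere 0 1 \<inter> V) (\<lambda>x. x \<bullet> f x)"
    by (intro continuous_intros linear_continuous_on linear_conv_bounded_linear[THEN iffD1] f)
  ultimately obtain v where v: "v \<in> sphere 0 1 \<inter> V"
    and sup: "\<And>y. y \<in> sphere 0 1 \<inter> V \<Longrightarrow> y \<bullet> f y \<le> v \<bullet> f v"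
    using continuous_attains_sup by metis
  define \<mu> where "\<mu> = v \<bullet> f v"
  \<comment> \<open>\<open>q\<close> is the homogeneous form of the maximality bound, valid on all
    of \<open>V\<close> without normalising; it vanishes at \<open>v\<close>.\<close>
  define q where "q y = \<mu> * (y \<bullet> y) - y \<bullet> f y" for y
  have q_nonneg: "q y \<ge> 0" if "y \<in> V" for y
  proof (cases "y = 0")
    case True
    then show ?thesis by (simp add: q_def)
  next
    case False
    then have "y /\<^sub>R norm y \<in> sphere 0 1 \<inter> V"
      using that V by (simp add: subspace_scale)
    from sup[OF this] have "(y \<bullet> f y) / (norm y)\<^sup>2 \<le> \<mu>"
      using f by (simp add: \<mu>_def linear_scale power2_eq_square field_simps)
    with False show ?thesis
      by (simp add: q_def divide_le_eq power2_norm_eq_inner)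
  qed
  \<comment> \<open>The residual of the eigenvector equation; invariance of \<open>V\<close> under
    \<open>f\<close> keeps it an admissible direction.\<close>
  define w where "w = \<mu> *\<^sub>R v - f v"
  have w: "w \<in> V"
    using v V inv by (simp add: w_def subspace_diff subspace_scale)
  have vv: "v \<bullet> v = 1"
    using v by (simp add: norm_eq_1)
  have fvw: "v \<bullet> f w = f v \<bullet> w" "w \<bullet> f v = f v \<bullet> w"
    using sa by (auto simp: inner_commute)
  \<comment> \<open>\<open>q\<close> is minimal at \<open>v\<close>, and its derivative there in direction \<open>w\<close> is \<open>2 \<parallel>w\<parallel>\<^sup>2\<close>.\<close>
  have expand: "q (v + s *\<^sub>R w) = 2 * s * (w \<bullet> w) + s\<^sup>2 * q w" for s
  proof -
    have "q (v + s *\<^sub>R w) = (\<mu> * (v \<bullet> v) - v \<bullet> f v) + 2 * s * (\<mu> * (v \<bullet> w) - f v \<bullet> w) + s\<^sup>2 * q w"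
      using f fvw by (simp add: q_def linear_add linear_scale inner_add_left inner_add_right
          inner_commute[of w v] power2_eq_square algebra_simps)
    also have "\<mu> * (v \<bullet> w) - f v \<bullet> w = w \<bullet> w"
      by (subst (3) w_def) (simp add: inner_diff_left)
    finally show ?thesis
      by (simp add: vv \<mu>_def)
  qed
  have "w = 0"
  proof (rule ccontr)
    assume "w \<noteq> 0"
    define a where "a = w \<bullet> w"
    \<comment> \<open>A negative step for which the linear term wins: \<open>2 * a + s * q w\<close>
      becomes \<open>a + a / (q w + 1) > 0\<close>. The summand 1 keeps the denominator positive
      when \<open>q w = 0\<close>.\<close>
    define s where "s = - a / (q w + 1)"
    have a: "a > 0"
      using \<open>w \<noteq> 0\<close> by (simp add: a_def)
    have qw: "q w \<ge> 0"
      using q_nonneg w by blast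
    have "s < 0"
      using a qw by (simp add: s_def divide_neg_pos)
    moreover have "v + s *\<^sub>R w \<in> V"
      using v w V by (simp add: subspace_add subspace_scale)
    then have "0 \<le> s * (2 * a + s * q w)"
      using q_nonneg[of "v + s *\<^sub>R w"] expand[of s]
      by (simp add: a_def power2_eq_square algebra_simps)
    ultimately have "2 * a + s * q w \<le> 0"
      by (simp add: zero_le_mult_iff)
    moreover have "s * q w = a / (q w + 1) - a"
      using qw by (simp add: s_def field_simps)
    moreover have "a / (q w + 1) > 0"
      using a qw by simp
    ultimately show False
      using a by linarith
  qed
  then show thesis
    using that[of v \<mu>] v by (simp add: w_def)
qed

text \<open>An orthonormal set of eigenvectors of greatest cardinality must span: otherwise its
  orthogonal complement is nonzero and invariant, and contains one more unit eigenvector.\<close>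

lemma self_adjoint_orthonormal_eigenbasis:
  fixes f :: "'a::euclidean_space \<Rightarrow> 'a"
  assumes f: "linear f" and sa: "\<And>x y. f x \<bullet> y = x \<bullet> f y"
  obtains B where "pairwise orthogonal B" "card B = DIM('a)" "finite B"
    "\<And>b. b \<in> B \<Longrightarrow> norm b = 1" "\<And>b. b \<in> B \<Longrightarrow> \<exists>\<mu>. f b = \<mu> *\<^sub>R b"
proof -
  define E where "E B \<longleftrightarrow> pairwise orthogonal B \<and> (\<forall>b\<in>B. norm b = 1 \<and> (\<exists>\<mu>. f b = \<mu> *\<^sub>R b))"
    for B :: "'a set"
  have indep: "independent B" if "E B" for B
    using that by (intro pairwise_orthogonal_independent) (auto simp: E_def)
  have "E {}"
    by (simp add: E_def)
  moreover have "\<forall>B. E B \<longrightarrow> card B < Suc (DIM('a))"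
    using indep independent_bound by (metis le_imp_less_Suc)
  ultimately obtain B where B: "E B" and max: "\<And>C. E C \<Longrightarrow> card C \<le> card B"
    using ex_has_greatest_nat[of E "{}" card] by metis
  have fin: "finite B" and le: "card B \<le> DIM('a)"
    using indep[OF B] independent_bound by auto
  have "card B = DIM('a)"
  proof (rule ccontr)
    assume "card B \<noteq> DIM('a)"
    then have "dim (span B) < DIM('a)"
      using le indep[OF B] by (simp add: dim_eq_card_independent)
    then obtain x where x: "x \<noteq> 0" "\<And>y. y \<in> span B \<Longrightarrow> orthogonal x y"
      using orthogonal_to_subspace_exists[of "span B"] by (auto simp: span_span)
    define V where "V = {x. \<forall>b\<in>B. b \<bullet> x = 0}"
    have "subspace V"
      by (auto simp: V_def subspace_def inner_add_right)
    \<comment> \<open>Self-adjointness moves \<open>f\<close> onto the eigenvector \<open>b\<close>,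
      which is merely rescaled.\<close>
    moreover have "f y \<in> V" if "y \<in> V" for y
      unfolding V_def
    proof safe
      fix b assume b: "b \<in> B"
      then obtain \<mu> where "f b = \<mu> *\<^sub>R b"
        using B by (auto simp: E_def)
      then show "b \<bullet> f y = 0"
        using that b by (simp add: V_def flip: sa)
    qed
    moreover have "x \<in> V"
      using x(2) by (auto simp: V_def orthogonal_def inner_commute span_base)
    ultimately obtain v \<mu> where v: "v \<in> V" "norm v = 1" "f v = \<mu> *\<^sub>R v"
      using self_adjoint_eigenvector_in_subspace[OF f sa] x(1) by metis
    \<comment> \<open>A member of \<open>B\<close> lying in \<open>V\<close> would be orthogonal to
      itself, contrary to \<open>norm v = 1\<close>.\<close>
    have "v \<notin> B"
      using v by (auto simp: V_def)
    have "E (insert v B)"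
      using B v by (auto simp: E_def V_def pairwise_insert orthogonal_def inner_commute)
    from max[OF this] show False
      using \<open>v \<notin> B\<close> fin by simp
  qed
  with B fin show thesis
    using that by (auto simp: E_def)
qed

section \<open>Diagonal matrices and the spectral theorem in matrix form\<close>

definition diag_matrix :: "('n \<Rightarrow> 'a::zero) \<Rightarrow> 'a^'n^'n" where
  "diag_matrix d = (\<chi> i j. if i = j then d i else 0)"

lemma diag_matrix_nth: "diag_matrix d $ i $ j = (if i = j then d i else 0)"
  by (simp add: diag_matrix_def)

lemma diag_matrix_mult_nth:
  fixes X :: "'a::semiring_1^'m^'n"
  shows "(diag_matrix d ** X) $ i $ j = d i * X $ i $ j"
  by (simp add: matrix_matrix_mult_def diag_matrix_nth if_distrib[of "\<lambda>x. x * _"] cong: if_cong)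

lemma mult_diag_matrix_nth:
  fixes X :: "'a::semiring_1^'n^'m"
  shows "(X ** diag_matrix d) $ i $ j = X $ i $ j * d j"
  by (simp add: matrix_matrix_mult_def diag_matrix_nth if_distrib[of "\<lambda>x. _ * x"] cong: if_cong)

lemma diag_matrix_vector_nth:
  fixes d :: "'n::finite \<Rightarrow> 'a::semiring_1"
  shows "(diag_matrix d *v x) $ i = d i * x $ i"
  by (simp add: matrix_vector_mult_def diag_matrix_nth if_distrib[of "\<lambda>x. x * _"] cong: if_cong)

lemma diag_matrix_mult_diag_matrix:
  fixes d e :: "'n::finite \<Rightarrow> 'a::semiring_1"
  shows "diag_matrix d ** diag_matrix e = diag_matrix (\<lambda>i. d i * e i)"
  by (simp add: vec_eq_iff diag_matrix_mult_nth) (simp add: diag_matrix_nth)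

lemma diag_matrix_one: "diag_matrix (\<lambda>_. 1) = mat 1"
  by (simp add: vec_eq_iff diag_matrix_nth mat_def)

lemma transpose_diag_matrix: "transpose (diag_matrix d) = diag_matrix d"
  by (auto simp: vec_eq_iff transpose_def diag_matrix_nth)

text \<open>The columns of \<open>U\<close> are an orthonormal eigenbasis, indexed by
  \<open>'n\<close> through a bijection \<open>h\<close>.\<close>

lemma symmetric_matrix_diagonalisation:
  fixes M :: "real^'n^'n"
  assumes "transpose M = M"
  obtains U :: "real^'n^'n" and d where "transpose U ** U = mat 1" "U ** transpose U = mat 1"
    "M = U ** diag_matrix d ** transpose U"
proof -
  have "(M *v x) \<bullet> y = x \<bullet> (M *v y)" for x y
    using assms by (metis dot_lmul_matrix transpose_matrix_vector)
  then obtain B where B: "pairwise orthogonal B" "card B = CARD('n)" "finite B"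
    "\<And>b. b \<in> B \<Longrightarrow> norm b = 1" "\<And>b. b \<in> B \<Longrightarrow> \<exists>\<mu>. M *v b = \<mu> *\<^sub>R b"
    using self_adjoint_orthonormal_eigenbasis[of "(*v) M"] by (auto simp: matrix_vector_mul_linear)
  obtain h where h: "bij_betw h (UNIV :: 'n set) B"
    using finite_same_card_bij[of "UNIV :: 'n set" B] B by auto
  have hB: "h i \<in> B" for i
    using h by (auto simp: bij_betw_def)
  obtain d where d: "\<And>i. M *v h i = d i *\<^sub>R h i"
    using B(5)[OF hB] by metis
  have orth: "h i \<bullet> h j = (if i = j then 1 else 0)" for i j
  proof (cases "i = j")
    case True
    then show ?thesis using B(4)[OF hB] by (simp add: norm_eq_1)
  next
    case False
    then have "h i \<noteq> h j"
      using h by (metis UNIV_I bij_betw_def inj_onD)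
    then show ?thesis
      using B(1) hB False by (auto simp: pairwise_def orthogonal_def)
  qed
  define U :: "real^'n^'n" where "U = (\<chi> i j. h j $ i)"
  have U1: "transpose U ** U = mat 1"
    using orth by (simp add: vec_eq_iff U_def matrix_matrix_mult_def transpose_def mat_def inner_vec_def)
  then have U2: "U ** transpose U = mat 1"
    by (simp add: matrix_left_right_inverse)
  have "(M ** U) $ i $ j = (U ** diag_matrix d) $ i $ j" for i j
  proof -
    have "(M ** U) $ i $ j = (M *v h j) $ i"
      by (simp add: matrix_matrix_mult_def matrix_vector_mult_def U_def)
    then show ?thesis
      by (simp add: d mult_diag_matrix_nth U_def)
  qed
  then have "M ** U = U ** diag_matrix d"
    by (simp add: vec_eq_iff)
  then have "M = U ** diag_matrix d ** transpose U"
    using U2 by (metis matrix_mul_assoc matrix_mul_rid)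
  with U1 U2 show thesis
    using that by blast
qed

subsection \<open>Positive definite matrices\<close>

text \<open>A one-sided inverse of a square matrix over a field is two-sided, so the choice hidden
  in \<open>matrix_inv\<close> is forced.\<close>

lemma matrix_inv_unique:
  fixes A B :: "'a::field^'n^'n"
  assumes "A ** B = mat 1"
  shows "matrix_inv A = B"
proof -
  have "B ** A = mat 1"
    using assms by (simp add: matrix_left_right_inverse)
  then have "A ** B = mat 1 \<and> B ** A = mat 1"
    using assms by blast
  then have "matrix_inv A ** A = mat 1"
    unfolding matrix_inv_def by (rule someI2) blast
  have "matrix_inv A = matrix_inv A ** (A ** B)"
    by (simp only: assms matrix_mul_rid)
  also have "\<dots> = B"
    by (simp only: matrix_mul_assoc \<open>matrix_inv A ** A = mat 1\<close> matrix_mul_lid)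
  finally show ?thesis .
qed

lemma pos_def_matrix_inv_mult:
  assumes "pos_def M"
  shows "M ** matrix_inv M = mat 1" "matrix_inv M ** M = mat 1"
proof -
  obtain N where N: "M ** N = mat 1" "N ** M = mat 1"
    using pos_def_invertible[OF assms] unfolding invertible_def by blast
  then show "M ** matrix_inv M = mat 1" "matrix_inv M ** M = mat 1"
    by (simp_all only: matrix_inv_unique[OF N(1)])
qed

text \<open>Supplies the trivial-kernel hypothesis of \<open>pos_def_congruence\<close> whenever a
  left inverse is known.\<close>

lemma left_inverse_mult_eq_0:
  fixes A :: "'a::semiring_1^'n^'m"
  assumes "A ** B = mat 1" "B *v x = 0"
  shows "x = 0"
proof -
  have "x = (A ** B) *v x"
    by (simp add: assms(1))
  also have "\<dots> = A *v (B *v x)"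
    by (simp only: matrix_vector_mul_assoc)
  finally show ?thesis
    by (simp add: assms(2))
qed

text \<open>The new quadratic form at \<open>x\<close> is that of \<open>M\<close> at
  \<open>P *v x\<close>. \<open>P\<close> may be rectangular, as it is later for
  \<open>transpose S\<close>.\<close>

lemma pos_def_congruence:
  fixes M :: "real^'n^'n" and P :: "real^'m^'n"
  assumes "pos_def M" and "\<And>x. P *v x = 0 \<Longrightarrow> x = 0"
  shows "pos_def (transpose P ** M ** P)"
proof -
  have "x \<bullet> ((transpose P ** M ** P) *v x) = (P *v x) \<bullet> (M *v (P *v x))" for x
    by (metis dot_lmul_matrix matrix_vector_mul_assoc transpose_matrix_vector inner_commute)
  moreover have "transpose (transpose P ** M ** P) = transpose P ** M ** P"
    using assms(1) by (simp add: pos_def_def matrix_transpose_mul matrix_mul_assoc)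
  ultimately show ?thesis
    using assms unfolding pos_def_def by metis
qed

text \<open>By symmetry the inverse is the congruence of \<open>M\<close> by
  \<open>matrix_inv M\<close> itself.\<close>

lemma pos_def_matrix_inv:
  assumes "pos_def M"
  shows "pos_def (matrix_inv M)"
proof -
  note inv = pos_def_matrix_inv_mult[OF assms]
  have sym: "transpose (matrix_inv M) = matrix_inv M"
    using matrix_inv_unique[of M "transpose (matrix_inv M)"] inv assms
    by (metis matrix_transpose_mul pos_def_def transpose_mat)
  have "pos_def (transpose (matrix_inv M) ** M ** matrix_inv M)"
    using assms
    by (rule pos_def_congruence) (rule left_inverse_mult_eq_0[OF inv(1)])
  then show ?thesis
    using inv sym by simp
qed

lemma pos_def_diag_matrix_iff: "pos_def (diag_matrix d) \<longleftrightarrow> (\<forall>i. d i > 0)"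
proof
  assume *: "pos_def (diag_matrix d)"
  show "\<forall>i. d i > 0"
  proof
    fix i
    have "axis i 1 \<bullet> (diag_matrix d *v axis i 1) > 0"
      using * by (simp add: pos_def_def axis_eq_0_iff)
    then show "d i > 0"
      by (simp add: inner_axis' diag_matrix_vector_nth)
  qed
next
  assume *: "\<forall>i. d i > 0"
  have "x \<bullet> (diag_matrix d *v x) > 0" if x: "x \<noteq> 0" for x
  proof -
    obtain i where i: "x $ i \<noteq> 0"
      using x by (auto simp: vec_eq_iff)
    have "x \<bullet> (diag_matrix d *v x) = (\<Sum>i\<in>UNIV. d i * (x $ i)\<^sup>2)"
      by (simp add: inner_vec_def diag_matrix_vector_nth power2_eq_square mult_ac)
    also have "\<dots> > 0"
      using * i by (intro sum_pos2[of _ i]) (auto simp: less_imp_le)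
    finally show ?thesis .
  qed
  then show "pos_def (diag_matrix d)"
    by (simp add: pos_def_def transpose_diag_matrix)
qed

text \<open>Since \<open>U\<close> is orthogonal, \<open>diag_matrix d\<close> is a congruence of
  \<open>M\<close>, hence positive definite.\<close>

lemma pos_def_diagonalisation:
  fixes M :: "real^'n^'n"
  assumes "pos_def M"
  obtains U :: "real^'n^'n" and d where "transpose U ** U = mat 1" "U ** transpose U = mat 1"
    "M = U ** diag_matrix d ** transpose U" "\<And>i. d i > 0"
proof -
  obtain U :: "real^'n^'n" and d where U: "transpose U ** U = mat 1" "U ** transpose U = mat 1"
    "M = U ** diag_matrix d ** transpose U"
    using symmetric_matrix_diagonalisation assms unfolding pos_def_def by metis
  have "pos_def (transpose U ** M ** U)"
    using assms
    by (rule pos_def_congruence) (rule left_inverse_mult_eq_0[OF U(1)])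
  also have "transpose U ** M ** U = diag_matrix d"
    unfolding U(3) by (metis U(1) matrix_mul_assoc matrix_mul_lid matrix_mul_rid)
  finally show thesis
    using U that by (simp add: pos_def_diag_matrix_iff)
qed

text \<open>Take square roots of the eigenvalues in an orthonormal eigenbasis.\<close>

lemma pos_def_sqrt_exists:
  fixes M :: "real^'n^'n"
  assumes "pos_def M"
  shows "\<exists>R. pos_def R \<and> R ** R = M"
proof -
  obtain U :: "real^'n^'n" and d where U: "transpose U ** U = mat 1" "U ** transpose U = mat 1"
    "M = U ** diag_matrix d ** transpose U" and d: "\<And>i. d i > 0"
    using pos_def_diagonalisation[OF assms] by metis
  define D where "D = diag_matrix (\<lambda>i. sqrt (d i))"
  have DD: "D ** D = diag_matrix d"
    using d by (simp add: D_def diag_matrix_mult_diag_matrix less_imp_le)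
  have "pos_def (transpose (transpose U) ** D ** transpose U)"
  proof (rule pos_def_congruence)
    show "pos_def D"
      using d by (simp add: D_def pos_def_diag_matrix_iff)
  qed (rule left_inverse_mult_eq_0[OF U(2)])
  then have "pos_def (U ** D ** transpose U)"
    by (simp only: transpose_transpose)
  moreover have "(U ** D ** transpose U) ** (U ** D ** transpose U)
      = U ** D ** (transpose U ** U) ** D ** transpose U"
    by (simp only: matrix_mul_assoc)
  then have "(U ** D ** transpose U) ** (U ** D ** transpose U) = M"
    by (simp only: U(1) matrix_mul_rid U(3) DD flip: matrix_mul_assoc[of U D D])
  ultimately show ?thesis
    by blast
qed

text \<open>The difference of the two roots is symmetric, so it vanishes once its eigenvalues do;
  each eigenvalue times a positive number turns out to be zero.\<close>

lemma pos_def_sqrt_unique: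
  fixes R R' :: "real^'n^'n"
  assumes R: "pos_def R" "pos_def R'" and eq: "R ** R = R' ** R'"
  shows "R = R'"
proof -
  define D where "D = R - R'"
  have sym: "transpose D = D"
    using R by (simp add: D_def pos_def_def transpose_def vec_eq_iff)
  obtain U :: "real^'n^'n" and d where U: "transpose U ** U = mat 1" "U ** transpose U = mat 1"
    "D = U ** diag_matrix d ** transpose U"
    using symmetric_matrix_diagonalisation[OF sym] by metis
  have "d i = 0" for i
  proof -
    define v where "v = U *v axis i 1"
    have "transpose U *v v = axis i 1"
      by (simp add: v_def matrix_vector_mul_assoc U(1))
    then have "v \<noteq> 0"
      by (metis axis_eq_0_iff matrix_vector_mult_0_right zero_neq_one)
    have "D *v v = (U ** diag_matrix d) *v (transpose U *v v)"
      unfolding U(3) by (rule matrix_vector_mul_assoc[symmetric])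
    also have "\<dots> = U *v (diag_matrix d *v axis i 1)"
      unfolding \<open>transpose U *v v = axis i 1\<close> by (rule matrix_vector_mul_assoc[symmetric])
    also have "diag_matrix d *v axis i 1 = d i *\<^sub>R axis i 1"
      by (simp add: vec_eq_iff diag_matrix_vector_nth axis_def)
    finally have Dv: "D *v v = d i *\<^sub>R v"
      by (simp add: v_def matrix_vector_mult_scaleR)
    \<comment> \<open>\<open>R D + D R' = R\<^sup>2 - R'\<^sup>2 = 0\<close>; test this with the eigenvector \<open>v\<close> on both sides.\<close>
    have "v \<bullet> (R *v (D *v v)) + (D *v v) \<bullet> (R' *v v) = 0"
    proof -
      have "(D *v v) \<bullet> (R' *v v) = v \<bullet> (D *v (R' *v v))"
        using sym by (metis dot_lmul_matrix transpose_matrix_vector)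
      moreover have "R *v (D *v v) + D *v (R' *v v) = (R ** R) *v v - (R' ** R') *v v"
        by (simp add: D_def matrix_vector_mult_diff_rdistrib matrix_vector_mult_diff_distrib
            flip: matrix_vector_mul_assoc)
      ultimately show ?thesis
        by (metis eq diff_self inner_add_right inner_zero_right)
    qed
    then have "d i * (v \<bullet> (R *v v) + v \<bullet> (R' *v v)) = 0"
      by (simp add: Dv matrix_vector_mult_scaleR algebra_simps)
    moreover have "v \<bullet> (R *v v) > 0" "v \<bullet> (R' *v v) > 0"
      using R \<open>v \<noteq> 0\<close> by (auto simp: pos_def_def)
    ultimately show ?thesis
      by auto
  qed
  then have "diag_matrix d = 0"
    by (simp add: vec_eq_iff diag_matrix_nth)
  then have "D = 0"
    using U(3) by simp
  then show ?thesis
    by (simp add: D_def)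
qed

text \<open>Existence and uniqueness together give the definite description in
  \<open>pd_sqrt\<close> its meaning.\<close>

lemma pd_sqrt:
  assumes "pos_def M"
  shows "pos_def (pd_sqrt M)" "pd_sqrt M ** pd_sqrt M = M"
proof -
  have "\<exists>!R. pos_def R \<and> R ** R = M"
    using pos_def_sqrt_exists[OF assms] pos_def_sqrt_unique by metis
  from theI'[OF this] show "pos_def (pd_sqrt M)" "pd_sqrt M ** pd_sqrt M = M"
    by (simp_all add: pd_sqrt_def)
qed

text \<open>Take \<open>P = R ** U\<close>: the root \<open>R\<close> of the inverse of
  \<open>T\<close> normalises \<open>T\<close> to the identity, and the orthogonal \<open>U\<close>
  then diagonalises the transformed \<open>K\<close> without disturbing that identity.\<close>

lemma pos_def_simultaneous_diagonalisation:
  fixes T K :: "real^'n^'n"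
  assumes T: "pos_def T" and K: "pos_def K"
  obtains P :: "real^'n^'n" and d where "transpose P ** T ** P = mat 1" "transpose P ** K ** P = diag_matrix d"
    "\<And>i. d i > 0"
proof -
  define R where "R = pd_sqrt (matrix_inv T)"
  have R: "transpose R = R" "R ** R = matrix_inv T"
    using pd_sqrt[OF pos_def_matrix_inv[OF T]] by (auto simp: R_def pos_def_def)
  note Tinv = pos_def_matrix_inv_mult[OF T]
  have "R ** (R ** T) = mat 1"
    by (simp add: matrix_mul_assoc R Tinv)
  \<comment> \<open>\<open>R ** T\<close> is a right inverse of the square matrix \<open>R\<close>,
    hence also a left inverse.\<close>
  then have RTR: "R ** T ** R = mat 1"
    by (simp add: matrix_left_right_inverse)
  have "pos_def (transpose R ** K ** R)"
    using K
    by (rule pos_def_congruence) (rule left_inverse_mult_eq_0[OF RTR])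
  then obtain U :: "real^'n^'n" and d where U: "transpose U ** U = mat 1"
    "transpose R ** K ** R = U ** diag_matrix d ** transpose U" "\<And>i. d i > 0"
    using pos_def_diagonalisation by metis
  show thesis
  proof
    have "transpose (R ** U) ** T ** (R ** U) = transpose U ** (R ** T ** R) ** U"
      by (simp add: matrix_transpose_mul R matrix_mul_assoc)
    then show "transpose (R ** U) ** T ** (R ** U) = mat 1"
      by (simp add: RTR U)
    have "transpose (R ** U) ** K ** (R ** U) = transpose U ** (transpose R ** K ** R) ** U"
      by (simp add: matrix_transpose_mul matrix_mul_assoc)
    also have "\<dots> = diag_matrix d"
      unfolding U(2) by (metis U(1) matrix_mul_assoc matrix_mul_lid matrix_mul_rid)
    finally show "transpose (R ** U) ** K ** (R ** U) = diag_matrix d" .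
  qed (rule U(3))
qed

subsection \<open>Matrix arithmetic and complexification\<close>

lemma matrix_mult_uminus_left:
  fixes A :: "'a::ring_1^'n^'m"
  shows "(- A) ** B = - (A ** B)"
  by (simp add: vec_eq_iff matrix_matrix_mult_def sum_negf)

lemma matrix_mult_uminus_right:
  fixes A :: "'a::ring_1^'n^'m"
  shows "A ** (- B) = - (A ** B)"
  by (simp add: vec_eq_iff matrix_matrix_mult_def sum_negf)

lemma transpose_uminus: "transpose (- A) = - transpose A"
  by (simp add: vec_eq_iff transpose_def)

lemma transpose_scaleR: "transpose (t *\<^sub>R A) = t *\<^sub>R transpose A"
  by (simp add: vec_eq_iff transpose_def)

lemma trace_scaleR: "trace (t *\<^sub>R A) = t *\<^sub>R trace A"
  by (simp add: trace_def scaleR_sum_right)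

lemma matrix_mult_scaleR_left:
  fixes A :: "real^'n^'m"
  shows "(t *\<^sub>R A) ** B = t *\<^sub>R (A ** B)"
  by (simp add: vec_eq_iff matrix_matrix_mult_def sum_distrib_left mult_ac)

lemma matrix_mult_scaleR_right:
  fixes A :: "real^'n^'m"
  shows "A ** (t *\<^sub>R B) = t *\<^sub>R (A ** B)"
  by (simp add: vec_eq_iff matrix_matrix_mult_def sum_distrib_left mult_ac)

lemma complex_matrix_mult: "complex_matrix (A ** B) = complex_matrix A ** complex_matrix B"
  by (simp add: vec_eq_iff matrix_matrix_mult_def)

lemma complex_matrix_mat: "complex_matrix (mat 1) = mat 1"
  by (simp add: vec_eq_iff mat_def)

lemma complex_matrix_uminus: "complex_matrix (- A) = - complex_matrix A"
  by (simp add: vec_eq_iff)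

lemma complex_matrix_diag_matrix:
  "complex_matrix (diag_matrix d) = diag_matrix (\<lambda>i. complex_of_real (d i))"
  by (simp add: vec_eq_iff diag_matrix_nth)

lemma complex_matrix_transpose: "complex_matrix (transpose A) = transpose (complex_matrix A)"
  by (simp add: vec_eq_iff transpose_def)

subsection \<open>The Cauchy density\<close>

text \<open>Rescaling by \<open>d\<close> reduces this to the integral of
  \<open>inverse (1 + x\<^sup>2)\<close>; the Jacobian \<open>d\<close> cancels the factor
  \<open>1 / d\<close> in the integrand.\<close>

lemma has_bochner_integral_cauchy:
  assumes "d > 0"
  shows "has_bochner_integral lborel (\<lambda>\<omega>. d / (d\<^sup>2 + \<omega>\<^sup>2)) pi"
proof -
  have "has_bochner_integral lborel (\<lambda>x::real. inverse (1 + x\<^sup>2)) pi"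
    using integrable_inverse_1_plus_square LBINT_inverse_1_plus_square
    by (simp add: has_bochner_integral_iff set_integrable_def interval_lebesgue_integral_def
        set_lebesgue_integral_def)
  from lborel_has_bochner_integral_real_affine_iff[THEN iffD1, OF _ this, of "1 / d" 0] assms
  have "has_bochner_integral lborel (\<lambda>x. inverse (1 + (x / d)\<^sup>2)) (d * pi)"
    by simp
  from has_bochner_integral_mult_right[OF this, of "1 / d"] assms
  have "has_bochner_integral lborel (\<lambda>x. 1 / d * inverse (1 + (x / d)\<^sup>2)) pi"
    by simp
  also have "(\<lambda>x. 1 / d * inverse (1 + (x / d)\<^sup>2)) = (\<lambda>\<omega>. d / (d\<^sup>2 + \<omega>\<^sup>2))"
    using assms by (auto simp: fun_eq_iff field_simps power2_eq_square)
  finally show ?thesis .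
qed

subsection \<open>Transfer function and norm of a diagonalisable system\<close>

text \<open>In modal coordinates an eigenvector is one of \<open>- diag_matrix d\<close>, so a
  nonzero component \<open>i\<close> identifies the eigenvalue as \<open>- d i\<close>.\<close>

lemma hurwitz_diagonalisable:
  fixes P Z :: "real^'n^'n"
  assumes PZ: "P ** Z = mat 1" and d: "\<And>i. d i > 0"
  shows "hurwitz (- (P ** diag_matrix d ** Z))"
  unfolding hurwitz_def
proof (intro allI impI, elim conjE)
  fix l v
  assume v: "v \<noteq> 0"
    and eig: "complex_matrix (- (P ** diag_matrix d ** Z)) *v v = l *s v"
  have ZP: "Z ** P = mat 1"
    using PZ by (simp add: matrix_left_right_inverse)
  define w where "w = complex_matrix Z *v v"
  have "w \<noteq> 0"
    using v left_inverse_mult_eq_0[of "complex_matrix P" "complex_matrix Z" v]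
    by (auto simp: w_def PZ complex_matrix_mat simp flip: complex_matrix_mult)
  then obtain i where i: "w $ i \<noteq> 0"
    by (auto simp: vec_eq_iff)
  have "Z ** - (P ** diag_matrix d ** Z) = - ((Z ** P) ** diag_matrix d ** Z)"
    by (simp only: matrix_mult_uminus_right matrix_mul_assoc)
  also have "\<dots> = - (diag_matrix d ** Z)"
    by (simp only: ZP matrix_mul_lid)
  finally have *: "Z ** - (P ** diag_matrix d ** Z) = - (diag_matrix d ** Z)" .
  have "l *s w = complex_matrix Z *v (complex_matrix (- (P ** diag_matrix d ** Z)) *v v)"
    by (simp only: eig w_def vector_scalar_commute)
  also have "\<dots> = complex_matrix (- (diag_matrix d ** Z)) *v v"
    by (simp only: matrix_vector_mul_assoc * flip: complex_matrix_mult)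
  also have "\<dots> = - (diag_matrix (\<lambda>i. complex_of_real (d i)) *v w)"
    by (simp only: complex_matrix_uminus complex_matrix_mult complex_matrix_diag_matrix w_def
        matrix_vector_mul_assoc) (simp add: vec_eq_iff matrix_vector_mult_def sum_negf)
  finally have "l * w $ i = - (complex_of_real (d i) * w $ i)"
    by (metis diag_matrix_vector_nth vector_smult_component vector_uminus_component)
  then have "(l + complex_of_real (d i)) * w $ i = 0"
    by (simp add: algebra_simps)
  with i have "l = - complex_of_real (d i)"
    by (simp add: eq_neg_iff_add_eq_0)
  then show "Re l < 0"
    using d by simp
qed

text \<open>\<open>s I - A\<close> factors as \<open>P\<close>, times the diagonal matrix of the
  \<open>s + d i\<close>, times \<open>Z\<close>, and is inverted factor by factor; the hypothesis
  on \<open>s\<close> keeps it off the spectrum.\<close>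

lemma transfer_function_diagonalisable:
  fixes P Z :: "real^'n^'n"
  assumes PZ: "P ** Z = mat 1" and s: "\<And>i. s + complex_of_real (d i) \<noteq> 0"
  shows "transfer_function (- (P ** diag_matrix d ** Z)) B C s =
    complex_matrix (C ** P) ** diag_matrix (\<lambda>i. 1 / (s + complex_of_real (d i))) ** complex_matrix (Z ** B)"
proof -
  let ?D = "diag_matrix (\<lambda>i. complex_of_real (d i))"
  let ?R = "diag_matrix (\<lambda>i. 1 / (s + complex_of_real (d i)))"
  let ?E = "diag_matrix (\<lambda>i. s + complex_of_real (d i))"
  let ?P = "complex_matrix P" and ?Z = "complex_matrix Z"
  have PZc: "?P ** ?Z = mat 1"
    by (simp add: PZ complex_matrix_mat flip: complex_matrix_mult)
  then have ZPc: "?Z ** ?P = mat 1"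
    by (simp add: matrix_left_right_inverse)
  have "?E = mat s + ?D"
    by (simp add: vec_eq_iff diag_matrix_nth mat_def)
  then have "?P ** ?E ** ?Z = ?P ** mat s ** ?Z + ?P ** ?D ** ?Z"
    by (simp add: vec_eq_iff matrix_matrix_mult_def distrib_left distrib_right sum.distrib)
  \<comment> \<open>Scalar matrices commute with everything, so the scalar part collapses by
    \<open>PZc\<close>.\<close>
  also have "?P ** mat s = mat s ** ?P"
    by (simp add: vec_eq_iff matrix_matrix_mult_def mat_def mult.commute
        if_distrib[of "\<lambda>x. x * _"] cong: if_cong)
  also have "mat s ** ?P ** ?Z = mat s"
    by (simp only: PZc matrix_mul_rid flip: matrix_mul_assoc)
  finally have "mat s - complex_matrix (- (P ** diag_matrix d ** Z)) = ?P ** ?E ** ?Z"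
    by (simp add: complex_matrix_uminus complex_matrix_mult complex_matrix_diag_matrix)
  moreover have "matrix_inv (?P ** ?E ** ?Z) = ?P ** ?R ** ?Z"
  proof (rule matrix_inv_unique)
    have "(?P ** ?E ** ?Z) ** (?P ** ?R ** ?Z) = ?P ** (?E ** ((?Z ** ?P) ** ?R)) ** ?Z"
      by (simp only: matrix_mul_assoc)
    also have "?E ** ((?Z ** ?P) ** ?R) = mat 1"
      using s by (simp add: ZPc diag_matrix_mult_diag_matrix diag_matrix_one)
    finally show "(?P ** ?E ** ?Z) ** (?P ** ?R ** ?Z) = mat 1"
      by (simp add: PZc)
  qed
  ultimately show ?thesis
    by (simp only: transfer_function_def complex_matrix_mult matrix_mul_assoc)
qed

text \<open>Plain squares appear, even over the complex numbers, because the transpose does not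
  conjugate. The uses are the integrand and, with weights 1, the final trace.\<close>

lemma trace_congruence_diag_matrix:
  fixes X :: "'a::comm_semiring_1^'m^'n"
  shows "trace (transpose X ** diag_matrix g ** X) = (\<Sum>i\<in>UNIV. g i * (\<Sum>j\<in>UNIV. (X $ i $ j)\<^sup>2))"
proof -
  have "trace (transpose X ** diag_matrix g ** X) = (\<Sum>j\<in>UNIV. \<Sum>i\<in>UNIV. g i * (X $ i $ j)\<^sup>2)"
    unfolding trace_def
    by (simp add: matrix_matrix_mult_def[of "_ ** _" X] mult_diag_matrix_nth transpose_def
        power2_eq_square mult_ac)
  also have "\<dots> = (\<Sum>i\<in>UNIV. g i * (\<Sum>j\<in>UNIV. (X $ i $ j)\<^sup>2))"
    by (subst sum.swap) (simp add: sum_distrib_left)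
  finally show ?thesis .
qed

text \<open>Hypothesis \<open>C\<close> makes the modes orthogonal at the output, with weights equal
  to their decay rates \<open>d i\<close>; this equality turns each mode into a Cauchy
  density.\<close>

lemma h2_norm_diagonalisable:
  fixes P Z :: "real^'n^'n"
  assumes PZ: "P ** Z = mat 1" and d: "\<And>i. d i > 0"
    and C: "transpose (C ** P) ** (C ** P) = diag_matrix d"
  shows "(h2_norm (- (P ** diag_matrix d ** Z)) B C)\<^sup>2 = 1 / 2 * trace (transpose (Z ** B) ** (Z ** B))"
proof -
  define X where "X = Z ** B"
  define Y where "Y = C ** P"
  define G where "G = transfer_function (- (P ** diag_matrix d ** Z)) B C"
  define e where "e s = diag_matrix (\<lambda>i. 1 / (s + complex_of_real (d i)))" for s
  \<comment> \<open>Squared length of row \<open>i\<close> of \<open>X\<close>: how strongly the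
    input excites mode \<open>i\<close>.\<close>
  define x where "x i = (\<Sum>j\<in>UNIV. (X $ i $ j)\<^sup>2)" for i
  have YY: "transpose (complex_matrix Y) ** complex_matrix Y = diag_matrix (\<lambda>i. complex_of_real (d i))"
    using C by (metis Y_def complex_matrix_diag_matrix complex_matrix_mult complex_matrix_transpose)
  have integrand: "trace (transpose (G (- (\<i> * complex_of_real \<omega>))) ** G (\<i> * complex_of_real \<omega>))
      = complex_of_real (\<Sum>i\<in>UNIV. d i / ((d i)\<^sup>2 + \<omega>\<^sup>2) * x i)" for \<omega>
  proof -
    define s where "s = \<i> * complex_of_real \<omega>"
    \<comment> \<open>\<open>s\<close> is purely imaginary while \<open>d i\<close> is a positive
      real.\<close>
    have nz: "s + complex_of_real (d i) \<noteq> 0" "- s + complex_of_real (d i) \<noteq> 0" for i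
      using d[of i] by (auto simp: s_def complex_eq_iff)
    have G: "G s = complex_matrix Y ** e s ** complex_matrix X"
      "G (- s) = complex_matrix Y ** e (- s) ** complex_matrix X"
      unfolding G_def X_def Y_def e_def
      by (rule transfer_function_diagonalisable[OF PZ], rule nz)+
    have "transpose (G (- s)) ** G s = transpose (complex_matrix X) **
        (e (- s) ** (transpose (complex_matrix Y) ** complex_matrix Y) ** e s) ** complex_matrix X"
      by (simp only: G matrix_transpose_mul matrix_mul_assoc) (simp add: e_def transpose_diag_matrix matrix_mul_assoc)
    also have "e (- s) ** (transpose (complex_matrix Y) ** complex_matrix Y) ** e s
        = diag_matrix (\<lambda>i. complex_of_real (d i / ((d i)\<^sup>2 + \<omega>\<^sup>2)))"
    proof -
      have "(- s + complex_of_real (d i)) * (s + complex_of_real (d i)) = complex_of_real ((d i)\<^sup>2 + \<omega>\<^sup>2)" for i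
        by (simp add: s_def complex_eq_iff power2_eq_square algebra_simps)
      then have "1 / (- s + complex_of_real (d i)) * complex_of_real (d i) * (1 / (s + complex_of_real (d i)))
        = complex_of_real (d i / ((d i)\<^sup>2 + \<omega>\<^sup>2))" for i
        by simp
      then show ?thesis
        by (simp only: YY e_def diag_matrix_mult_diag_matrix)
    qed
    finally have "trace (transpose (G (- s)) ** G s)
        = complex_of_real (\<Sum>i\<in>UNIV. d i / ((d i)\<^sup>2 + \<omega>\<^sup>2) * x i)"
      by (simp add: trace_congruence_diag_matrix x_def)
    then show ?thesis
      by (simp only: s_def)
  qed
  have "has_bochner_integral lborel (\<lambda>\<omega>. \<Sum>i\<in>UNIV. d i / ((d i)\<^sup>2 + \<omega>\<^sup>2) * x i) (\<Sum>i\<in>UNIV. pi * x i)"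
    by (intro has_bochner_integral_sum has_bochner_integral_mult_left has_bochner_integral_cauchy d)
  then have "(LBINT \<omega>. \<Sum>i\<in>UNIV. d i / ((d i)\<^sup>2 + \<omega>\<^sup>2) * x i) = pi * (\<Sum>i\<in>UNIV. x i)"
    by (simp add: has_bochner_integral_integral_eq sum_distrib_left)
  then have "h2_norm (- (P ** diag_matrix d ** Z)) B C = sqrt (1 / 2 * (\<Sum>i\<in>UNIV. x i))"
    by (simp only: h2_norm_def Let_def integrand integral_complex_of_real Re_complex_of_real flip: G_def) simp
  \<comment> \<open>Nonnegativity lets the square undo the \<open>sqrt\<close> in
    \<open>h2_norm\<close>.\<close>
  moreover have "(\<Sum>i\<in>UNIV. x i) \<ge> 0"
    by (simp add: x_def sum_nonneg)
  moreover have "(\<Sum>i\<in>UNIV. x i) = trace (transpose X ** X)"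
    using trace_congruence_diag_matrix[of X "\<lambda>_. 1"] by (simp add: diag_matrix_one x_def)
  ultimately show ?thesis
    by (simp add: X_def)
qed

section \<open>The dual ascent system\<close>

theorem mainTheorem4:
  fixes Q :: "real^'x^'x" and T :: "real^'r^'r"
    and S :: "real^'x^'r" and W :: "real^'b^'r" and t :: real
  assumes "CARD('r) < CARD('x)"
    and "pos_def Q" and "pos_def T"
    and "rank S = CARD('r)" and "rank W = CARD('r)"
    and "t \<ge> 0"
  shows "hurwitz (dual_ascent_A T Q S) \<and>
         (h2_norm (dual_ascent_A T Q S) (dual_ascent_B T t W) (dual_ascent_C Q S))\<^sup>2
           = t\<^sup>2 / 2 * trace (transpose W ** matrix_inv T ** W)"
proof -
  define K where "K = S ** matrix_inv Q ** transpose S"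
  \<comment> \<open>Full row rank of \<open>S\<close> is injectivity of \<open>transpose S\<close>,
    which makes \<open>K\<close> positive definite.\<close>
  have S_ker: "x = 0" if "transpose S *v x = 0" for x
  proof -
    have "inj ((*v) (transpose S))"
      using assms(4) by (simp only: flip: full_rank_injective rank_transpose[of S])
    then show ?thesis
      using that by (metis injD matrix_vector_mult_0_right)
  qed
  have K: "pos_def K"
    using pos_def_congruence[OF pos_def_matrix_inv[OF assms(2)], of "transpose S", OF S_ker]
    by (simp only: K_def transpose_transpose)
  obtain P :: "real^'r^'r" and d where PTP: "transpose P ** T ** P = mat 1"
    and PKP: "transpose P ** K ** P = diag_matrix d" and d: "\<And>i. d i > 0"
    using pos_def_simultaneous_diagonalisation[OF assms(3) K] by metis
  \<comment> \<open>The normalisation of \<open>T\<close> gives the inverse of \<open>P\<close>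
    explicitly.\<close>
  define Z where "Z = transpose P ** T"
  have PZ: "P ** Z = mat 1"
    using PTP by (simp add: Z_def matrix_left_right_inverse)
  have T_sym: "transpose T = T" "transpose (matrix_inv T) = matrix_inv T"
    using assms(3) pos_def_matrix_inv by (auto simp: pos_def_def)
  note T_inv = pos_def_matrix_inv_mult[OF assms(3)]
  have "P ** transpose P = P ** Z ** matrix_inv T"
    by (simp only: Z_def T_inv matrix_mul_rid flip: matrix_mul_assoc)
  then have PP: "P ** transpose P = matrix_inv T"
    by (simp add: PZ)
  \<comment> \<open>Substituting \<open>PKP\<close> for the diagonal matrix leaves
    \<open>matrix_inv T ** K\<close>, which is minus the state matrix.\<close>
  have "P ** diag_matrix d ** Z = (P ** transpose P) ** K ** (P ** Z)"
    by (simp only: PKP[symmetric] matrix_mul_assoc)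
  then have A: "dual_ascent_A T Q S = - (P ** diag_matrix d ** Z)"
    by (simp add: PP PZ dual_ascent_A_def K_def)
  define C where "C = dual_ascent_C Q S"
  note R = pd_sqrt[OF pos_def_matrix_inv[OF assms(2)]]
  \<comment> \<open>The two signs cancel and the symmetric square root multiplies back to
    \<open>matrix_inv Q\<close>.\<close>
  have "transpose C ** C = S ** (transpose (pd_sqrt (matrix_inv Q)) ** pd_sqrt (matrix_inv Q)) ** transpose S"
    by (simp add: C_def dual_ascent_C_def transpose_uminus matrix_transpose_mul matrix_mult_uminus_left
        matrix_mult_uminus_right matrix_mul_assoc)
  also have "\<dots> = K"
    using R by (simp add: pos_def_def K_def)
  finally have "transpose (C ** P) ** (C ** P) = diag_matrix d"
    by (simp add: matrix_transpose_mul PKP[symmetric] matrix_mul_assoc)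
       (simp only: flip: matrix_mul_assoc)
  note h2 = h2_norm_diagonalisable[OF PZ d this, of "dual_ascent_B T t W"]
  have ZB: "Z ** dual_ascent_B T t W = - (t *\<^sub>R (transpose P ** W))"
  proof -
    have "Z ** (matrix_inv T ** W) = transpose P ** ((T ** matrix_inv T) ** W)"
      by (simp only: Z_def matrix_mul_assoc)
    then show ?thesis
      by (simp add: T_inv dual_ascent_B_def matrix_mult_uminus_right matrix_mult_scaleR_right)
  qed
  \<comment> \<open>The modal matrices recombine into \<open>P ** transpose P\<close>, the inverse
    of \<open>T\<close>, so no trace of \<open>d\<close> or \<open>K\<close> remains.\<close>
  have "transpose (transpose P ** W) ** (transpose P ** W) = transpose W ** (P ** transpose P) ** W"
    by (simp add: matrix_transpose_mul matrix_mul_assoc)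
  then have "trace (transpose (Z ** dual_ascent_B T t W) ** (Z ** dual_ascent_B T t W))
      = t\<^sup>2 * trace (transpose W ** matrix_inv T ** W)"
    by (simp add: ZB PP transpose_uminus transpose_scaleR matrix_mult_uminus_left matrix_mult_uminus_right
        matrix_mult_scaleR_left matrix_mult_scaleR_right trace_scaleR power2_eq_square)
  with h2 show ?thesis
    using hurwitz_diagonalisable[OF PZ d] by (simp add: A C_def)
qed

end
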